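(* Let $n\ge 0$ and let $R_n$ be the free rack on $n$ generators $y_1,\dots,y_n$. Let $t$ be a closed term over the signature $\Sigma(x,y_1,\dots,y_n)$. Then $[t]$ belongs to the logical isotropy group $G_{\mathrm{Rack}}(R_n)$ if and only if there are $p,m\ge 0$, indices $1\le i_1,\dots,i_m\le n$, and signs $\delta_1,\dots,\delta_p\in\{1,-1\}$, $\epsilon_1,\dots,\epsilon_m\in\{1,-1\}$ such that $$[t]=\left[x\lhd^{\delta_1}x\lhd^{\delta_2}\cdots\lhd^{\delta_p}x\lhd^{\epsilon_1}y_{i_1}\lhd^{\epsilon_2}\cdots\lhd^{\epsilon_m}y_{i_m}\right]$$ (an initial $x$ acted on successively by $p$ copies of $x$ with exponents $\delta_1,\dots,\delta_p$ and then by $y_{i_1},\dots,y_{i_m}$ with exponents $\epsilon_1,\dots,\epsilon_m$), and the corresponding group word $x^{\delta_1}\cdots x^{\delta_p}y_{i_1}^{\epsilon_1}\cdots y_{i_m}^{\epsilon_m}$ is reduced.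
   Context: A rack is a set with two binary operations $\lhd,\lhd^{-1}$ satisfying, for all $x,y,z$: $(x\lhd y)\lhd z=(x\lhd z)\lhd(y\lhd z)$; $(x\lhd^{-1}y)\lhd^{-1}z=(x\lhd^{-1}z)\lhd^{-1}(y\lhd^{-1}z)$; $(x\lhd y)\lhd^{-1}y=x$; $(x\lhd^{-1}y)\lhd y=x$. We write $\lhd^{1}=\lhd$, and bracketing associates to the left: $a\lhd^{\epsilon_1}b_1\lhd^{\epsilon_2}\cdots\lhd^{\epsilon_m}b_m$ means $(\cdots((a\lhd^{\epsilon_1}b_1)\lhd^{\epsilon_2}b_2)\cdots)\lhd^{\epsilon_m}b_m$ (which is $a$ if $m=0$). For a finite set $X$ of constants, $\Sigma(X)$ is the signature with binary symbols $\lhd,\lhd^{-1}$ and the elements of $X$ as constants. For closed terms $s,t$ over $\Sigma(X)$, $s\sim t$ means that $s=t$ is provable from the rack axioms over $\Sigma(X)$; $[t]$ is the $\sim$-class of $t$. The free rack on $y_1,\dots,y_n$ is the set $R_n$ of $\sim$-classes of closed terms over $\Sigma(y_1,\dots,y_n)$. Let $x,x_0,x_1$ be further distinct constants, and let $t[s/x]$ denote the result of replacing every occurrence of $x$ in $t$ by $s$. The logical isotropy group $G_{\mathrm{Rack}}(R_n)$ is the set of all classes $[t]$ of closed terms $t$ over $\Sigma(x,y_1,\dots,y_n)$ (modulo provable equality in the theory of racks) such that: (1) $[t]$ is invertible: there is a closed term $s$ over $\Sigma(x,y_1,\dots,y_n)$ with $t[s/x]\sim x\sim s[t/x]$; and (2)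 $[t]$ commutes generically with the operations: $t[(x_0\lhd^{\epsilon} x_1)/x]\sim t[x_0/x]\lhd^{\epsilon} t[x_1/x]$ over $\Sigma(x_0,x_1,y_1,\dots,y_n)$ for $\epsilon=1$ and $\epsilon=-1$. It is a group with unit $[x]$ and product $[t]\cdot[s]=[t[s/x]]$. A group word $a_1^{\epsilon_1}\cdots a_m^{\epsilon_m}$ ($m\ge0$, $a_i$ letters, $\epsilon_i=\pm1$) is reduced if $a_i=a_{i+1}$ implies $\epsilon_i=\epsilon_{i+1}$ for all $1\le i<m$ (the empty word is identified with $e$ and is reduced). *)

theory Defs
  imports "HOL-Algebra.Group"
begin

text \<open>Exponents: \<open>Pos\<close> is \<open>1\<close>, \<open>Neg\<close> is \<open>-1\<close>.\<close>

datatype sign = Pos | Neg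

text \<open>
  \<open>Var v\<close> is a variable of equational logic and \<open>Con c\<close> a constant of the signature. The letters
  \<open>x, x\<^sub>0, x\<^sub>1, y\<^sub>i\<close> of the isotropy group are constants, not variables.
\<close>

datatype (con_set: 'c, var_set: 'v) rterm =
    Var 'v
  | Con 'c
  | Op "('c, 'v) rterm" sign "('c, 'v) rterm"  ("_ \<lhd>\<^bsup>_\<^esup> _" [65, 0, 66] 65)

definition rack_axioms :: "(('c, nat) rterm \<times> ('c, nat) rterm) set" where
  "rack_axioms =
    {((Var 0 \<lhd>\<^bsup>Pos\<^esup> Var 1) \<lhd>\<^bsup>Pos\<^esup> Var 2, (Var 0 \<lhd>\<^bsup>Pos\<^esup> Var 2) \<lhd>\<^bsup>Pos\<^esup> (Var 1 \<lhd>\<^bsup>Pos\<^esup> Var 2)),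
     ((Var 0 \<lhd>\<^bsup>Neg\<^esup> Var 1) \<lhd>\<^bsup>Neg\<^esup> Var 2, (Var 0 \<lhd>\<^bsup>Neg\<^esup> Var 2) \<lhd>\<^bsup>Neg\<^esup> (Var 1 \<lhd>\<^bsup>Neg\<^esup> Var 2)),
     ((Var 0 \<lhd>\<^bsup>Pos\<^esup> Var 1) \<lhd>\<^bsup>Neg\<^esup> Var 1, Var 0),
     ((Var 0 \<lhd>\<^bsup>Neg\<^esup> Var 1) \<lhd>\<^bsup>Pos\<^esup> Var 1, Var 0)}"

primrec var_subst :: "('v \<Rightarrow> ('c, 'w) rterm) \<Rightarrow> ('c, 'v) rterm \<Rightarrow> ('c, 'w) rterm" where
  "var_subst \<sigma> (Var v) = \<sigma> v"
| "var_subst \<sigma> (Con c) = Con c"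
| "var_subst \<sigma> (s \<lhd>\<^bsup>e\<^esup> t) = var_subst \<sigma> s \<lhd>\<^bsup>e\<^esup> var_subst \<sigma> t"

text \<open>
  Provability in equational logic from the rack axioms, over the signature with set of constants
  \<open>C\<close>: every term occurring in a derivation has its constants in \<open>C\<close>.
\<close>

inductive rack_provable :: "'c set \<Rightarrow> ('c, nat) rterm \<Rightarrow> ('c, nat) rterm \<Rightarrow> bool"
  for C :: "'c set" where
  axiom: "(s, t) \<in> rack_axioms \<Longrightarrow> rack_provable C s t"
| refl: "con_set t \<subseteq> C \<Longrightarrow> rack_provable C t t"
| sym: "rack_provable C s t \<Longrightarrow> rack_provable C t s"
| trans: "rack_provable C s t \<Longrightarrow> rack_provable C t u \<Longrightarrow> rack_provable C s u"
| cong: "rack_provable C s s' \<Longrightarrow> rack_provable C t t' \<Longrightarrow>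
    rack_provable C (s \<lhd>\<^bsup>e\<^esup> t) (s' \<lhd>\<^bsup>e\<^esup> t')"
| subst: "rack_provable C s t \<Longrightarrow> (\<And>v. con_set (\<sigma> v) \<subseteq> C) \<Longrightarrow>
    rack_provable C (var_subst \<sigma> s) (var_subst \<sigma> t)"

definition closed_terms :: "'c set \<Rightarrow> ('c, nat) rterm set" where
  "closed_terms C = {t. con_set t \<subseteq> C \<and> var_set t = {}}"

definition rack_class :: "'c set \<Rightarrow> ('c, nat) rterm \<Rightarrow> ('c, nat) rterm set" where
  "rack_class C t = {s \<in> closed_terms C. rack_provable C t s}"

datatype letter = X | X0 | X1 | Y nat

definition generators :: "nat \<Rightarrow> letter set" where
  "generators n = Y ` {1..n}"

definition free_rack :: "nat \<Rightarrow> (letter, nat) rterm set set" where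
  "free_rack n = rack_class (generators n) ` closed_terms (generators n)"

text \<open>\<open>subst_x t s\<close> is \<open>t[s/x]\<close>.\<close>

primrec subst_x :: "(letter, 'v) rterm \<Rightarrow> (letter, 'v) rterm \<Rightarrow> (letter, 'v) rterm" where
  "subst_x (Var v) s = Var v"
| "subst_x (Con c) s = (if c = X then s else Con c)"
| "subst_x (t \<lhd>\<^bsup>e\<^esup> u) s = subst_x t s \<lhd>\<^bsup>e\<^esup> subst_x u s"

abbreviation x_gens :: "nat \<Rightarrow> letter set" where
  "x_gens n \<equiv> insert X (generators n)"

definition isotropy_invertible :: "nat \<Rightarrow> (letter, nat) rterm \<Rightarrow> bool" where
  "isotropy_invertible n t \<longleftrightarrow>
    (\<exists>s \<in> closed_terms (x_gens n).
      rack_provable (x_gens n) (subst_x t s) (Con X) \<and>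
      rack_provable (x_gens n) (Con X) (subst_x s t))"

definition commutes_generically :: "nat \<Rightarrow> (letter, nat) rterm \<Rightarrow> bool" where
  "commutes_generically n t \<longleftrightarrow>
    (\<forall>e. rack_provable ({X0, X1} \<union> generators n)
      (subst_x t (Con X0 \<lhd>\<^bsup>e\<^esup> Con X1))
      (subst_x t (Con X0) \<lhd>\<^bsup>e\<^esup> subst_x t (Con X1)))"

text \<open>
  The logical isotropy group of \<open>free_rack n\<close>. On classes \<open>P = [t]\<close>, \<open>Q = [s]\<close> the product is the
  class of \<open>t[s/x]\<close>; the union over representatives only avoids choosing them.
\<close>

definition rack_isotropy_group :: "nat \<Rightarrow> (letter, nat) rterm set monoid" where
  "rack_isotropy_group n =
    \<lparr>carrier = {rack_class (x_gens n) t |t. t \<in> closed_terms (x_gens n) \<and>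
        isotropy_invertible n t \<and> commutes_generically n t},
     monoid.mult = (\<lambda>P Q. \<Union>t\<in>P. \<Union>s\<in>Q. rack_class (x_gens n) (subst_x t s)),
     one = rack_class (x_gens n) (Con X)\<rparr>"

text \<open>The list \<open>[(b\<^sub>1, \<epsilon>\<^sub>1), \<dots>, (b\<^sub>m, \<epsilon>\<^sub>m)]\<close> stands for the group word with letters \<open>b\<^sub>i\<close> and
  exponents \<open>\<epsilon>\<^sub>i\<close>.\<close>

definition act_word :: "('c, 'v) rterm \<Rightarrow> ('c \<times> sign) list \<Rightarrow> ('c, 'v) rterm" where
  "act_word a w = foldl (\<lambda>s (b, e). s \<lhd>\<^bsup>e\<^esup> Con b) a w"

definition reduced_word :: "('c \<times> sign) list \<Rightarrow> bool" where
  "reduced_word w \<longleftrightarrow>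
    (\<forall>i. Suc i < length w \<longrightarrow> fst (w ! i) = fst (w ! Suc i) \<longrightarrow> snd (w ! i) = snd (w ! Suc i))"

end

theory Submission
  imports Defs
begin

text \<open>
  The free rack on \<open>A\<close> is \<open>A \<times> F(A)\<close> with
  \<open>(a, g) \<lhd>\<^bsup>e\<^esup> (b, h) = (a, g h\<^sup>-\<^sup>1 b\<^sup>e h)\<close>, so a term over \<open>x, y\<^sub>1, \<dots>, y\<^sub>n\<close> amounts to a letter together
  with an element \<open>w\<close> of the free group. Invertibility forces the letter to be \<open>x\<close>. More generally,
  every map \<open>d\<close> from \<open>A\<close> to a group \<open>G\<close> makes \<open>A \<times> G\<close> a rack, with \<open>d(b)\<^sup>e\<close> in place of \<open>b\<^sup>e\<close>.
  Reading generic commutation with \<open>\<lhd>\<close> in this rack with \<open>x\<^sub>0 \<mapsto> 1\<close>, \<open>x\<^sub>1 \<mapsto> x\<close> shows that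
  \<open>w u\<^sup>-\<^sup>1\<close> commutes with \<open>x\<close>, where \<open>u\<close> is obtained from \<open>w\<close> by putting \<open>x = 1\<close>. The centralizer of
  a generator of a free group is the cyclic group it generates, hence \<open>w = x\<^sup>k u\<close>. Conversely, if
  \<open>w = x\<^sup>k u\<close> with \<open>u\<close> free of \<open>x\<close>, then \<open>x\<^sup>-\<^sup>k u\<^sup>-\<^sup>1\<close> gives the inverse, and generic commutation is
  a computation in the free group.
\<close>

section \<open>Free groups\<close>

primrec opp :: "sign \<Rightarrow> sign" where
  "opp Pos = Neg"
| "opp Neg = Pos"

lemma opp_opp [simp]: "opp (opp e) = e"
  by (cases e) auto

lemma opp_neq [simp]: "opp e \<noteq> e" "e \<noteq> opp e"
  by (cases e; simp)+

lemma eq_opp_iff: "f = opp e \<longleftrightarrow> e \<noteq> f"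
  by (cases e; cases f) auto

definition letter_inv :: "'c \<times> sign \<Rightarrow> 'c \<times> sign" where
  "letter_inv p = (fst p, opp (snd p))"

lemma letter_inv_pair [simp]: "letter_inv (b, e) = (b, opp e)"
  by (simp add: letter_inv_def)

lemma letter_inv_inv [simp]: "letter_inv (letter_inv p) = p"
  by (simp add: letter_inv_def)

lemma letter_inv_neq [simp]: "p \<noteq> letter_inv p"
  by (simp add: letter_inv_def prod_eq_iff)

definition word_inv :: "('c \<times> sign) list \<Rightarrow> ('c \<times> sign) list" where
  "word_inv w = rev (map letter_inv w)"

lemma word_inv_simps [simp]:
  "word_inv [] = []"
  "word_inv (p # w) = word_inv w @ [letter_inv p]"
  "word_inv (u @ v) = word_inv v @ word_inv u"
  by (simp_all add: word_inv_def)

lemma word_inv_inv [simp]: "word_inv (word_inv w) = w"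
  by (induction w) auto

lemma fst_set_word_inv [simp]: "fst ` set (word_inv w) = fst ` set w"
  by (simp add: word_inv_def image_image letter_inv_def)

lemma reduced_word_Nil [simp]: "reduced_word []"
  by (simp add: reduced_word_def)

lemma reduced_word_single [simp]: "reduced_word [p]"
  by (simp add: reduced_word_def)

text \<open>With only two signs, adjacent entries that violate the condition are exactly mutually
  inverse letters. This trades the indexed definition for a recursive one that suits induction on
  lists.\<close>

lemma reduced_word_Cons2 [simp]:
  "reduced_word (p # q # w) \<longleftrightarrow> q \<noteq> letter_inv p \<and> reduced_word (q # w)"
proof -
  have "(fst p = fst q \<longrightarrow> snd p = snd q) \<longleftrightarrow> q \<noteq> letter_inv p"
    by (auto simp: letter_inv_def prod_eq_iff eq_opp_iff)
  then show ?thesis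
    by (auto simp: reduced_word_def nth_Cons less_Suc_eq_0_disj split: nat.splits)
qed

lemma reduced_word_ConsD: "reduced_word (p # w) \<Longrightarrow> reduced_word w"
  by (cases w) auto

lemma reduced_word_append:
  assumes "reduced_word u" "reduced_word v" "fst ` set u \<inter> fst ` set v = {}"
  shows "reduced_word (u @ v)"
  using assms
proof (induction u)
  case (Cons p u)
  then have "reduced_word (u @ v)"
    by (auto dest: reduced_word_ConsD)
  with Cons.prems show ?case
    by (cases u; cases v) (auto simp: letter_inv_def)
qed simp

lemma reduced_word_replicate: "reduced_word (replicate k p)"
  by (simp add: reduced_word_def)

text \<open>Left multiplication of a reduced word by one letter, as in van der Waerden's
  construction of the free group: letters act on reduced words, and the normal form of
  \<open>w\<close> is the result of letting \<open>w\<close> act on the empty word. This replaces a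
  confluence argument for cancellation.\<close>

fun push :: "'c \<times> sign \<Rightarrow> ('c \<times> sign) list \<Rightarrow> ('c \<times> sign) list" where
  "push p [] = [p]"
| "push p (q # w) = (if q = letter_inv p then w else p # q # w)"

definition reduce :: "('c \<times> sign) list \<Rightarrow> ('c \<times> sign) list" where
  "reduce w = foldr push w []"

lemma reduce_simps [simp]:
  "reduce [] = []"
  "reduce (p # w) = push p (reduce w)"
  by (simp_all add: reduce_def)

lemma reduced_push: "reduced_word w \<Longrightarrow> reduced_word (push p w)"
  by (cases w) (auto dest: reduced_word_ConsD)

lemma reduced_reduce [simp]: "reduced_word (reduce w)"
  by (induction w) (auto intro: reduced_push)

text \<open>Each letter thus acts on reduced words as a permutation. Reducedness matters: once
  \<open>letter_inv p\<close> has cancelled a leading \<open>p\<close>, the rest must not begin with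
  \<open>letter_inv p\<close>, or the outer \<open>push\<close> would cancel again.\<close>

lemma push_push_inv:
  assumes "reduced_word w"
  shows "push p (push (letter_inv p) w) = w"
  using assms by (cases w rule: list.exhaust; cases "tl w") auto

lemma reduce_reduced: "reduced_word w \<Longrightarrow> reduce w = w"
proof (induction w)
  case (Cons p w)
  then have "reduce w = w"
    by (auto dest: reduced_word_ConsD)
  with Cons.prems show ?case
    by (cases w) auto
qed simp

lemma set_push: "set (push p w) \<subseteq> insert p (set w)"
  by (cases w) auto

lemma set_reduce: "set (reduce w) \<subseteq> set w"
proof (induction w)
  case (Cons p w)
  then show ?case
    using set_push[of p "reduce w"] by auto
qed simp

lemma reduce_append: "reduce (u @ v) = foldr push u (reduce v)"
  by (induction u) auto

lemma reduced_foldr_push: "reduced_word v \<Longrightarrow> reduced_word (foldr push u v)"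
  by (induction u) (auto intro: reduced_push)

text \<open>Only a cancellation inside \<open>push p u\<close> needs an argument: then
  \<open>u\<close> begins with \<open>letter_inv p\<close>, and \<open>push_push_inv\<close>
  applies. Consequently a word acts on reduced words through its reduced form alone.\<close>

lemma foldr_push_push:
  assumes "reduced_word v"
  shows "foldr push (push p u) v = push p (foldr push u v)"
proof (cases u)
  case (Cons q u')
  then show ?thesis
    using push_push_inv[of "foldr push u' v" p] reduced_foldr_push[OF assms] by auto
qed simp

lemma foldr_push_reduce:
  assumes "reduced_word v"
  shows "foldr push (reduce u) v = foldr push u v"
  by (induction u) (simp_all add: foldr_push_push[OF assms])

lemma reduce_append_cong:
  "reduce u = reduce u' \<Longrightarrow> reduce v = reduce v' \<Longrightarrow> reduce (u @ v) = reduce (u' @ v')"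
  by (metis foldr_push_reduce reduce_append reduced_reduce)

lemma reduce_cancel_left: "reduce (word_inv w @ w) = []"
proof -
  have "foldr push (word_inv w) (foldr push w v) = v" if "reduced_word v" for v
    using that
  proof (induction w)
    case (Cons p w)
    then show ?case
      using push_push_inv[OF reduced_foldr_push[OF Cons.prems], of "letter_inv p" w] by simp
  qed simp
  from this[of "[]"] show ?thesis
    by (simp add: reduce_append) (simp add: reduce_def)
qed

text \<open>Uniqueness of inverses modulo reduction:
  \<open>u^-1 = u^-1 v v^-1 = u^-1 u v^-1 = v^-1\<close>.\<close>

lemma reduce_word_inv_cong:
  assumes "reduce u = reduce v"
  shows "reduce (word_inv u) = reduce (word_inv v)"
proof -
  have "reduce (v @ word_inv v) = []"
    using reduce_cancel_left[of "word_inv v"] by simp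
  then have "reduce (word_inv u) = reduce (word_inv u @ (v @ word_inv v))"
    using reduce_append_cong[of "word_inv u" "word_inv u" "v @ word_inv v" "[]"] by simp
  also have "\<dots> = reduce (word_inv u @ (u @ word_inv v))"
    using assms by (intro reduce_append_cong) auto
  also have "\<dots> = reduce (word_inv v)"
    using reduce_append_cong[of "word_inv u @ u" "[]" "word_inv v" "word_inv v"]
    by (simp add: reduce_cancel_left)
  finally show ?thesis .
qed

\<comment> \<open>The free group as a quotient of words\<close>
quotient_type 'c free_group = "('c \<times> sign) list" / "\<lambda>u v. reduce u = reduce v"
  morphisms rep_free_group free_word
  by (auto intro!: equivpI simp: reflp_def symp_def transp_def)

text \<open>Written additively, since the library's class of not necessarily commutative groups is.\<close>

instantiation free_group :: (type) group_add
begin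

lift_definition zero_free_group :: "'a free_group" is "[]" .
lift_definition plus_free_group :: "'a free_group \<Rightarrow> 'a free_group \<Rightarrow> 'a free_group" is "(@)"
  by (rule reduce_append_cong)
lift_definition uminus_free_group :: "'a free_group \<Rightarrow> 'a free_group" is word_inv
  by (rule reduce_word_inv_cong)
definition minus_free_group :: "'a free_group \<Rightarrow> 'a free_group \<Rightarrow> 'a free_group" where
  "minus_free_group a b = a + - b"

instance
proof
  fix a b c :: "'a free_group"
  show "a + b + c = a + (b + c)"
    by transfer simp
  show "0 + a = a"
    by transfer simp
  show "a + 0 = a"
    by transfer simp
  show "- a + a = 0"
    by transfer (simp add: reduce_cancel_left)
  show "a + - b = a - b"
    by (simp add: minus_free_group_def)
qed

end

lemma free_word_Nil: "free_word [] = 0"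
  by (simp add: zero_free_group.abs_eq)

lemma free_word_append: "free_word (u @ v) = free_word u + free_word v"
  by (simp add: plus_free_group.abs_eq)

lemma free_word_eq_iff: "free_word u = free_word v \<longleftrightarrow> reduce u = reduce v"
  by (rule free_group.abs_eq_iff)

lemma free_word_reduce [simp]: "free_word (reduce u) = free_word u"
  by (simp add: free_word_eq_iff reduce_reduced)

lemma free_word_inv: "free_word (word_inv w) = - free_word w"
  by (simp add: uminus_free_group.abs_eq)

section \<open>Generators and evaluation of words in groups\<close>

definition gen :: "'c \<Rightarrow> 'c free_group" where
  "gen c = free_word [(c, Pos)]"

primrec sign_times :: "sign \<Rightarrow> 'g::group_add \<Rightarrow> 'g" where
  "sign_times Pos g = g"
| "sign_times Neg g = - g"

lemma sign_times_opp: "sign_times (opp e) g = - sign_times e g"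
  by (cases e) auto

definition word_eval :: "('c \<Rightarrow> 'g::group_add) \<Rightarrow> ('c \<times> sign) list \<Rightarrow> 'g" where
  "word_eval d w = sum_list (map (\<lambda>(b, e). sign_times e (d b)) w)"

lemma word_eval_simps [simp]:
  "word_eval d [] = 0"
  "word_eval d (p # w) = sign_times (snd p) (d (fst p)) + word_eval d w"
  "word_eval d (u @ v) = word_eval d u + word_eval d v"
  by (simp_all add: word_eval_def case_prod_beta)

lemma word_eval_word_inv: "word_eval d (word_inv w) = - word_eval d w"
  by (induction w) (auto simp: letter_inv_def sign_times_opp minus_add)

lemma word_eval_cong: "(\<And>b. b \<in> fst ` set w \<Longrightarrow> d b = d' b) \<Longrightarrow> word_eval d w = word_eval d' w"
  unfolding word_eval_def by (rule arg_cong[where f = sum_list]) force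

lemma word_eval_gen: "word_eval gen w = free_word w"
proof (induction w)
  case (Cons p w)
  obtain b e where p: "p = (b, e)"
    by fastforce
  have "sign_times e (gen b) = free_word [(b, e)]"
    using free_word_inv[of "[(b, Pos)]"] by (cases e) (simp_all add: gen_def)
  then show ?case
    using Cons free_word_append[of "[(b, e)]" w] by (simp add: p)
qed (simp add: free_word_Nil)

text \<open>Conjugation by \<open>g\<close> is a homomorphism. This serves the substitution of an
  element with group component \<open>g\<close> for x, which makes x act by a conjugate.\<close>

lemma word_eval_conjugate:
  "word_eval (\<lambda>b. - g + d b + g) w = - g + word_eval d w + g"
proof (induction w)
  case (Cons p w)
  have "sign_times e (- g + h + g) = - g + sign_times e h + g" for e h
    by (cases e) (simp_all add: minus_add add.assoc del: add_uminus_conv_diff)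
  with Cons show ?case
    by (cases p) (simp add: add.assoc)
qed simp

text \<open>The word evaluates to a multiple of \<open>g\<close>, so everything happens in a cyclic
  group.\<close>

lemma word_eval_commute:
  assumes "\<And>b. b \<in> fst ` set w \<Longrightarrow> d b = g"
  shows "word_eval d w + sign_times e g = sign_times e g + word_eval d w"
  using assms
proof (induction w)
  case (Cons p w)
  obtain b f where p: "p = (b, f)"
    by fastforce
  have "sign_times f g + sign_times e g = sign_times e g + sign_times f g"
    by (cases e; cases f) simp_all
  moreover have "d b = g"
    using Cons.prems by (simp add: p)
  moreover have "word_eval d w + sign_times e g = sign_times e g + word_eval d w"
    using Cons by simp
  ultimately show ?case
    by (simp add: p) (metis add.assoc)
qed simp

lemma word_eval_erase:
  fixes d :: "'c \<Rightarrow> 'g::group_add"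
  shows "word_eval (d(c := 0)) w = word_eval d (filter (\<lambda>p. fst p \<noteq> c) w)"
proof (induction w)
  case (Cons p w)
  have "sign_times e (0 :: 'g) = 0" for e
    by (cases e) auto
  with Cons show ?case
    by (cases p) simp
qed simp

section \<open>The centralizer of a generator\<close>

lemma reduce_snoc:
  assumes "reduced_word w"
  shows "reduce (w @ [p]) = w @ [p] \<or> length (reduce (w @ [p])) < length w"
  using assms
proof (induction w)
  case (Cons q w)
  then have IH: "reduce (w @ [p]) = w @ [p] \<or> length (reduce (w @ [p])) < length w"
    by (auto dest: reduced_word_ConsD)
  have "length (push q v) \<le> Suc (length v)" for v
    by (cases v) auto
  then have "length (reduce (w @ [p])) < length w \<Longrightarrow>
      length (reduce ((q # w) @ [p])) < length (q # w)"
    by (auto intro: le_less_trans)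
  \<comment> \<open>As \<open>q # w\<close> is reduced, \<open>q\<close> can cancel here only if
    \<open>w\<close> is empty and \<open>p\<close> is inverse to \<open>q\<close>.\<close>
  moreover have "push q (w @ [p]) = q # w @ [p] \<or> length (push q (w @ [p])) < Suc (length w)"
    using Cons.prems by (cases w) auto
  ultimately show ?case
    using IH by auto
qed simp

lemma strip_power:
  assumes "reduced_word w"
  obtains k e v where "w = replicate k (c, e) @ v" "reduced_word v" "v = [] \<or> fst (hd v) \<noteq> c"
proof -
  have "\<exists>k e v. w = replicate k (c, e) @ v \<and> reduced_word v \<and> (v = [] \<or> fst (hd v) \<noteq> c)"
    using assms
  proof (induction w)
    case (Cons p w)
    obtain b f where p: "p = (b, f)"
      by fastforce
    show ?case
    proof (cases "b = c")
      case True
      from Cons obtain k e v where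
        *: "w = replicate k (c, e) @ v" "reduced_word v" "v = [] \<or> fst (hd v) \<noteq> c"
        by (auto dest: reduced_word_ConsD)
      show ?thesis
      proof (cases k)
        \<comment> \<open>No power of \<open>c\<close> follows, so \<open>e\<close> carries no
          information and the sign \<open>f\<close> of the new letter is taken instead.\<close>
        case 0
        with * True p have "p # w = replicate 1 (c, f) @ v"
          by simp
        with * show ?thesis
          by blast
      next
        case (Suc k')
        with * True p Cons.prems have "f = e"
          by (cases e; cases f) auto
        with * True p have "p # w = replicate (Suc k) (c, e) @ v"
          by simp
        with * show ?thesis
          by blast
      qed
    next
      case False
      with p Cons.prems show ?thesis
        by (intro exI[of _ 0] exI[of _ Pos] exI[of _ "p # w"]) simp
    qed
  qed simp
  then show ?thesis
    using that by blast
qed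

text \<open>
  Strip the maximal power of \<open>c\<close> off the front of a reduced word. If a nonempty word \<open>v\<close> remained,
  then \<open>c v\<close> would be reduced and longer than \<open>v\<close>, while the reduced form of \<open>v c\<close> either starts
  with the first letter of \<open>v\<close>, which is not \<open>c\<close>, or is shorter than \<open>v\<close>.
\<close>

lemma centralizer_gen:
  assumes "g + gen c = gen c + g"
  obtains k e where "g = free_word (replicate k (c, e))"
proof -
  obtain w where w: "reduced_word w" "g = free_word w"
    using Quotient3_abs_rep[OF Quotient3_free_group, of g] by (metis free_word_reduce reduced_reduce)
  obtain k e v where kv: "w = replicate k (c, e) @ v" "reduced_word v" "v = [] \<or> fst (hd v) \<noteq> c"
    using strip_power[OF w(1)] .
  define h where "h = free_word (replicate k (c, e))"
  \<comment> \<open>The stripped power commutes with \<open>gen c\<close>, so it can be cancelled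
    from the hypothesis, and \<open>v\<close> commutes with \<open>gen c\<close> as well.\<close>
  have "h + gen c = gen c + h"
    using word_eval_commute[of "replicate k (c, e)" gen "gen c" Pos]
    by (force simp: h_def word_eval_gen)
  moreover have "g = h + free_word v"
    by (simp add: w kv h_def free_word_append)
  ultimately have "h + (free_word v + gen c) = h + (gen c + free_word v)"
    using assms by (metis add.assoc)
  then have "reduce (v @ [(c, Pos)]) = reduce ((c, Pos) # v)"
    unfolding add_left_cancel gen_def
    by (simp flip: free_word_append add: free_word_eq_iff)
  also have "\<dots> = (c, Pos) # v" if "v \<noteq> []"
    using kv(2,3) that by (intro reduce_reduced) (cases v; auto simp: letter_inv_def)
  finally have *: "reduce (v @ [(c, Pos)]) = (c, Pos) # v" if "v \<noteq> []"
    using that .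
  have "v = []"
  proof (rule ccontr)
    assume "v \<noteq> []"
    with * reduce_snoc[OF kv(2), of "(c, Pos)"] have "v @ [(c, Pos)] = (c, Pos) # v"
      by auto
    then have "hd v = (c, Pos)"
      using \<open>v \<noteq> []\<close> by (metis hd_append2 list.sel(1))
    with kv(3) \<open>v \<noteq> []\<close> show False
      by simp
  qed
  then show ?thesis
    using that w kv by simp
qed

section \<open>Evaluation in racks built from groups\<close>

text \<open>The rack of pairs of a letter and a group element from the overview, in additive
  notation. The letter is the leftmost leaf of the term; the group element collects everything that
  acts on it. For \<open>d = gen\<close> this is the model of the free rack.\<close>

primrec rack_eval :: "('c \<Rightarrow> 'g::group_add) \<Rightarrow> ('v \<Rightarrow> 'c \<times> 'g) \<Rightarrow> ('c, 'v) rterm \<Rightarrow> 'c \<times> 'g"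
where
  "rack_eval d \<rho> (Var v) = \<rho> v"
| "rack_eval d \<rho> (Con c) = (c, 0)"
| "rack_eval d \<rho> (s \<lhd>\<^bsup>e\<^esup> t) =
    (fst (rack_eval d \<rho> s),
     snd (rack_eval d \<rho> s) + (- snd (rack_eval d \<rho> t) + (sign_times e (d (fst (rack_eval d \<rho> t))) +
       snd (rack_eval d \<rho> t))))"

lemma rack_eval_var_subst:
  "rack_eval d \<rho> (var_subst \<sigma> t) = rack_eval d (\<lambda>v. rack_eval d \<rho> (\<sigma> v)) t"
  by (induction t) auto

lemma rack_eval_sound:
  "rack_provable C s t \<Longrightarrow> rack_eval d \<rho> s = rack_eval d \<rho> t"
proof (induction arbitrary: \<rho> rule: rack_provable.induct)
  case (axiom s t)
  then show ?case
    by (auto simp: rack_axioms_def add.assoc minus_add simp del: add_uminus_conv_diff)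
qed (simp_all add: rack_eval_var_subst)

lemma act_word_simps [simp]:
  "act_word s [] = s"
  "act_word s (p # w) = act_word (s \<lhd>\<^bsup>snd p\<^esup> Con (fst p)) w"
  "act_word s (u @ v) = act_word (act_word s u) v"
  by (simp_all add: act_word_def case_prod_beta)

lemma rack_eval_act_word:
  "rack_eval d \<rho> (act_word s w) =
    (fst (rack_eval d \<rho> s), snd (rack_eval d \<rho> s) + word_eval d w)"
  by (induction w arbitrary: s) (auto simp: add.assoc)

lemma con_set_act_word [simp]: "con_set (act_word s w) = con_set s \<union> fst ` set w"
  by (induction w arbitrary: s) simp_all

lemma var_set_act_word [simp]: "var_set (act_word s w) = var_set s"
  by (induction w arbitrary: s) simp_all

lemma closed_terms_simps [simp]:
  "Con c \<in> closed_terms C \<longleftrightarrow> c \<in> C"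
  "s \<lhd>\<^bsup>e\<^esup> t \<in> closed_terms C \<longleftrightarrow> s \<in> closed_terms C \<and> t \<in> closed_terms C"
  "act_word s w \<in> closed_terms C \<longleftrightarrow> s \<in> closed_terms C \<and> fst ` set w \<subseteq> C"
  by (auto simp: closed_terms_def)

lemma rack_class_eq_iff:
  assumes "t \<in> closed_terms C"
  shows "rack_class C s = rack_class C t \<longleftrightarrow> rack_provable C s t"
proof -
  have "rack_provable C t t"
    using assms by (auto simp: closed_terms_def intro: rack_provable.refl)
  then show ?thesis
    using assms unfolding rack_class_def
    by (blast intro: rack_provable.trans rack_provable.sym)
qed

section \<open>Normal forms of closed terms\<close>

context
  fixes C :: "'c set"
begin

abbreviation peq :: "('c, nat) rterm \<Rightarrow> ('c, nat) rterm \<Rightarrow> bool"  (infix "\<approx>" 50) where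
  "s \<approx> t \<equiv> rack_provable C s t"

lemmas [trans] = rack_provable.trans

lemma rack_axiom_instance:
  assumes "(s, t) \<in> rack_axioms" "con_set a \<subseteq> C" "con_set b \<subseteq> C" "con_set c \<subseteq> C"
  defines "\<sigma> \<equiv> \<lambda>v::nat. if v = 0 then a else if v = 1 then b else c"
  shows "var_subst \<sigma> s \<approx> var_subst \<sigma> t"
  by (rule rack_provable.subst[OF rack_provable.axiom[OF assms(1)]])
    (use assms in \<open>auto simp: \<sigma>_def\<close>)

lemma rack_cancel:
  assumes "con_set a \<subseteq> C" "con_set b \<subseteq> C"
  shows "a \<lhd>\<^bsup>e\<^esup> b \<lhd>\<^bsup>opp e\<^esup> b \<approx> a"
proof (cases e)
  case Pos
  then show ?thesis
    using rack_axiom_instance[of "Var 0 \<lhd>\<^bsup>Pos\<^esup> Var 1 \<lhd>\<^bsup>Neg\<^esup> Var 1" "Var 0" a b b] assms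
    by (simp add: rack_axioms_def)
next
  case Neg
  then show ?thesis
    using rack_axiom_instance[of "Var 0 \<lhd>\<^bsup>Neg\<^esup> Var 1 \<lhd>\<^bsup>Pos\<^esup> Var 1" "Var 0" a b b] assms
    by (simp add: rack_axioms_def)
qed

lemma rack_distrib_same:
  assumes "con_set a \<subseteq> C" "con_set b \<subseteq> C" "con_set c \<subseteq> C"
  shows "a \<lhd>\<^bsup>e\<^esup> b \<lhd>\<^bsup>e\<^esup> c \<approx> a \<lhd>\<^bsup>e\<^esup> c \<lhd>\<^bsup>e\<^esup> (b \<lhd>\<^bsup>e\<^esup> c)"
  using rack_axiom_instance[of "Var 0 \<lhd>\<^bsup>e\<^esup> Var 1 \<lhd>\<^bsup>e\<^esup> Var 2"
      "Var 0 \<lhd>\<^bsup>e\<^esup> Var 2 \<lhd>\<^bsup>e\<^esup> (Var 1 \<lhd>\<^bsup>e\<^esup> Var 2)" a b c] assms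
  by (cases e) (simp_all add: rack_axioms_def)

lemma cong_left: "s \<approx> s' \<Longrightarrow> con_set t \<subseteq> C \<Longrightarrow> s \<lhd>\<^bsup>e\<^esup> t \<approx> s' \<lhd>\<^bsup>e\<^esup> t"
  by (intro rack_provable.cong rack_provable.refl)

text \<open>The axioms distribute only equal signs. For opposite signs, undo the action of
  \<open>c\<close> on the right-hand side: equal-sign distributivity and cancellation leave
  \<open>a\<close> acted on by \<open>b\<close>, and acting with \<open>c\<close> again gives the
  left-hand side.\<close>

lemma rack_distrib:
  assumes "con_set a \<subseteq> C" "con_set b \<subseteq> C" "con_set c \<subseteq> C"
  shows "a \<lhd>\<^bsup>e\<^esup> b \<lhd>\<^bsup>f\<^esup> c \<approx> a \<lhd>\<^bsup>f\<^esup> c \<lhd>\<^bsup>e\<^esup> (b \<lhd>\<^bsup>f\<^esup> c)"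
proof (cases "e = f")
  case True
  then show ?thesis
    using rack_distrib_same assms by simp
next
  case False
  then have e: "e = opp f"
    by (cases e; cases f) auto
  let ?r = "a \<lhd>\<^bsup>f\<^esup> c \<lhd>\<^bsup>e\<^esup> (b \<lhd>\<^bsup>f\<^esup> c)"
  have "?r \<lhd>\<^bsup>e\<^esup> c \<approx> (a \<lhd>\<^bsup>f\<^esup> c \<lhd>\<^bsup>e\<^esup> c) \<lhd>\<^bsup>e\<^esup> (b \<lhd>\<^bsup>f\<^esup> c \<lhd>\<^bsup>e\<^esup> c)"
    using assms by (intro rack_distrib_same) auto
  also have "\<dots> \<approx> a \<lhd>\<^bsup>e\<^esup> b"
    unfolding e using assms by (intro rack_provable.cong rack_cancel)
  finally have "?r \<lhd>\<^bsup>e\<^esup> c \<lhd>\<^bsup>f\<^esup> c \<approx> a \<lhd>\<^bsup>e\<^esup> b \<lhd>\<^bsup>f\<^esup> c"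
    using assms by (intro cong_left)
  moreover have "?r \<lhd>\<^bsup>e\<^esup> c \<lhd>\<^bsup>f\<^esup> c \<approx> ?r"
    using rack_cancel[of ?r c e] assms by (simp add: e)
  ultimately show ?thesis
    by (blast intro: rack_provable.sym rack_provable.trans)
qed

lemma act_word_cong:
  "s \<approx> t \<Longrightarrow> fst ` set w \<subseteq> C \<Longrightarrow> act_word s w \<approx> act_word t w"
  by (induction w arbitrary: s t) (simp_all add: cong_left)

text \<open>An element with word \<open>v\<close> acts by the conjugate \<open>v^-1 b^e v\<close>.
  Peel off the last letter of \<open>v\<close>: rewrite \<open>s\<close> so that it ends in an
  action of that letter, then pull the letter outwards by \<open>rack_distrib\<close>.\<close>

lemma op_act_word:
  assumes "con_set s \<subseteq> C" "b \<in> C" "fst ` set v \<subseteq> C"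
  shows "s \<lhd>\<^bsup>e\<^esup> act_word (Con b) v \<approx> act_word s (word_inv v @ [(b, e)] @ v)"
  using assms
proof (induction v arbitrary: s rule: rev_induct)
  case Nil
  then show ?case
    by simp (intro rack_provable.refl, simp)
next
  case (snoc p v)
  obtain c f where p: "p = (c, f)"
    by fastforce
  let ?v = "act_word (Con b) v" and ?s = "s \<lhd>\<^bsup>opp f\<^esup> Con c"
  have con: "con_set ?v \<subseteq> C" "con_set (Con c) \<subseteq> C"
    using snoc.prems by (auto simp: p)
  have "s \<approx> ?s \<lhd>\<^bsup>f\<^esup> Con c"
    using rack_cancel[of s "Con c" "opp f"] snoc.prems by (auto simp: p intro: rack_provable.sym)
  then have "s \<lhd>\<^bsup>e\<^esup> (?v \<lhd>\<^bsup>f\<^esup> Con c) \<approx> ?s \<lhd>\<^bsup>f\<^esup> Con c \<lhd>\<^bsup>e\<^esup> (?v \<lhd>\<^bsup>f\<^esup> Con c)"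
    using con by (intro cong_left) auto
  also have "\<dots> \<approx> ?s \<lhd>\<^bsup>e\<^esup> ?v \<lhd>\<^bsup>f\<^esup> Con c"
    using snoc.prems con by (intro rack_provable.sym[OF rack_distrib]) auto
  also have "\<dots> \<approx> act_word ?s (word_inv v @ [(b, e)] @ v) \<lhd>\<^bsup>f\<^esup> Con c"
    using snoc.prems con by (intro cong_left snoc.IH) (auto simp: p)
  finally show ?case
    by (simp add: p)
qed

lemma closed_term_normal_form:
  assumes "t \<in> closed_terms C"
  obtains a w where "a \<in> C" "fst ` set w \<subseteq> C" "t \<approx> act_word (Con a) w"
proof -
  have "\<exists>a w. a \<in> C \<and> fst ` set w \<subseteq> C \<and> t \<approx> act_word (Con a) w"
    using assms
  proof (induction t)
    case (Var v)
    then show ?case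
      by (simp add: closed_terms_def)
  next
    case (Con c)
    then have "Con c \<approx> act_word (Con c) []"
      by (auto intro: rack_provable.refl)
    with Con show ?case
      by (metis closed_terms_simps(1) empty_subsetI image_empty list.set(1))
  next
    case (Op s e t)
    then obtain a u b v where
      a: "a \<in> C" "fst ` set u \<subseteq> C" "s \<approx> act_word (Con a) u" and
      b: "b \<in> C" "fst ` set v \<subseteq> C" "t \<approx> act_word (Con b) v"
      by auto
    have "s \<lhd>\<^bsup>e\<^esup> t \<approx> act_word (Con a) u \<lhd>\<^bsup>e\<^esup> act_word (Con b) v"
      using a b by (intro rack_provable.cong)
    also have "\<dots> \<approx> act_word (act_word (Con a) u) (word_inv v @ [(b, e)] @ v)"
      using a b by (intro op_act_word) auto
    finally have "s \<lhd>\<^bsup>e\<^esup> t \<approx> act_word (Con a) (u @ word_inv v @ [(b, e)] @ v)"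
      by simp
    moreover have "fst ` set (u @ word_inv v @ [(b, e)] @ v) \<subseteq> C"
      using a b by (simp add: image_Un)
    ultimately show ?case
      using a(1) by blast
  qed
  then show ?thesis
    using that by blast
qed

lemma act_word_push:
  assumes "con_set s \<subseteq> C" "fst p \<in> C" "fst ` set w \<subseteq> C"
  shows "act_word s (p # w) \<approx> act_word s (push p w)"
proof (cases "w \<noteq> [] \<and> hd w = letter_inv p")
  case True
  obtain b e where p: "p = (b, e)"
    by fastforce
  with True obtain w' where w: "w = (b, opp e) # w'"
    by (cases w) auto
  have "s \<lhd>\<^bsup>e\<^esup> Con b \<lhd>\<^bsup>opp e\<^esup> Con b \<approx> s"
    using assms by (intro rack_cancel) (auto simp: p)
  then show ?thesis
    using assms by (auto simp: p w intro: act_word_cong)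
next
  case False
  then have "push p w = p # w"
    by (cases w) auto
  moreover have "act_word s (p # w) \<approx> act_word s (p # w)"
    using assms by (intro rack_provable.refl) auto
  ultimately show ?thesis
    by simp
qed

lemma act_word_reduce:
  assumes "con_set s \<subseteq> C" "fst ` set w \<subseteq> C"
  shows "act_word s w \<approx> act_word s (reduce w)"
  using assms
proof (induction w arbitrary: s)
  case (Cons p w)
  obtain b e where p: "p = (b, e)"
    by fastforce
  have "act_word (s \<lhd>\<^bsup>e\<^esup> Con b) w \<approx> act_word (s \<lhd>\<^bsup>e\<^esup> Con b) (reduce w)"
    using Cons by (auto simp: p)
  then have "act_word s (p # w) \<approx> act_word s (p # reduce w)"
    by (simp add: p)
  also have "\<dots> \<approx> act_word s (push p (reduce w))"
    using Cons.prems set_reduce[of w] by (intro act_word_push) auto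
  finally show ?case
    by simp
qed (auto intro: rack_provable.refl)

text \<open>The value under \<open>gen\<close> determines the leading letter and the reduced word,
  so both terms are provably equal to one normal form. With soundness this turns provability between
  closed terms into computation in the free group. Closed terms have no variables, so later uses
  take the dummy valuation \<open>undefined\<close>.\<close>

lemma rack_eval_complete:
  assumes "s \<in> closed_terms C" "t \<in> closed_terms C" "rack_eval gen \<rho> s = rack_eval gen \<rho> t"
  shows "s \<approx> t"
proof -
  obtain a u where a: "a \<in> C" "fst ` set u \<subseteq> C" "s \<approx> act_word (Con a) u"
    using closed_term_normal_form[OF assms(1)] .
  obtain b v where b: "b \<in> C" "fst ` set v \<subseteq> C" "t \<approx> act_word (Con b) v"
    using closed_term_normal_form[OF assms(2)] .
  have "rack_eval gen \<rho> (act_word (Con a) u) = rack_eval gen \<rho> (act_word (Con b) v)"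
    using assms(3) rack_eval_sound[OF a(3)] rack_eval_sound[OF b(3)] by metis
  then have "a = b" "reduce u = reduce v"
    by (simp_all add: rack_eval_act_word word_eval_gen free_word_eq_iff)
  have "s \<approx> act_word (Con a) (reduce u)"
    by (rule rack_provable.trans[OF a(3) act_word_reduce]) (use a in auto)
  moreover have "t \<approx> act_word (Con a) (reduce u)"
    unfolding \<open>a = b\<close> \<open>reduce u = reduce v\<close>
    by (rule rack_provable.trans[OF b(3) act_word_reduce]) (use b in auto)
  ultimately show ?thesis
    by (blast intro: rack_provable.sym rack_provable.trans)
qed

end

section \<open>The isotropy group\<close>

lemma closed_subst_x:
  assumes "t \<in> closed_terms (insert X C)" "s \<in> closed_terms C'" "C \<subseteq> C'"
  shows "subst_x t s \<in> closed_terms C'"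
  using assms(1)
proof (induction t)
  case (Var v)
  then show ?case
    by (simp add: closed_terms_def)
next
  case (Con c)
  with assms show ?case
    by auto
next
  case (Op t1 e t2)
  then show ?case
    by auto
qed

text \<open>After x is replaced by \<open>s\<close>, each x that acts contributes the conjugate of
  \<open>d b\<close> by \<open>g\<close>, which is what the changed \<open>d\<close> records. If x
  is also the leading letter, the result starts from \<open>(b, g)\<close>, so \<open>g\<close> is
  added on the left.\<close>

lemma rack_eval_subst_x:
  fixes d :: "letter \<Rightarrow> 'g::group_add"
  assumes "t \<in> closed_terms C" "rack_eval d \<rho> s = (b, g)"
    and "rack_eval (d(X := - g + d b + g)) \<rho>' t = (a, h)"
  shows "rack_eval d \<rho> (subst_x t s) = (if a = X then (b, g + h) else (a, h))"
proof -
  define D where "D = d(X := - g + d b + g)"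
  have D: "D X = - g + d b + g" "\<And>c. c \<noteq> X \<Longrightarrow> D c = d c"
    by (simp_all add: D_def)
  show ?thesis
    using assms(1) assms(3)[folded D_def]
  proof (induction t arbitrary: a h)
    case (Var v)
    then show ?case
      by (simp add: closed_terms_def)
  next
    case (Con c)
    then show ?case
      using assms(2) by auto
  next
    case (Op t1 e t2)
    obtain a1 h1 a2 h2 where
      1: "rack_eval D \<rho>' t1 = (a1, h1)" and 2: "rack_eval D \<rho>' t2 = (a2, h2)"
      by fastforce
    have conj: "sign_times e (- g + (d b + g)) = - g + (sign_times e (d b) + g)"
      by (cases e) (simp_all add: minus_add add.assoc del: add_uminus_conv_diff)
    have "rack_eval d \<rho> (subst_x t1 s) = (if a1 = X then (b, g + h1) else (a1, h1))"
      "rack_eval d \<rho> (subst_x t2 s) = (if a2 = X then (b, g + h2) else (a2, h2))"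
      using Op 1 2 by auto
    then show ?case
      using Op.prems 1 2
      by (auto simp: D conj add.assoc minus_add simp del: add_uminus_conv_diff)
  qed
qed

text \<open>The two halves of the word in the theorem, named so that facts about their letters can
  be stated separately.\<close>

definition x_word :: "sign list \<Rightarrow> (letter \<times> sign) list" where
  "x_word ds = map (\<lambda>d. (X, d)) ds"

definition y_word :: "(nat \<times> sign) list \<Rightarrow> (letter \<times> sign) list" where
  "y_word ys = map (\<lambda>(i, e). (Y i, e)) ys"

text \<open>The prefix \<open>g\<close> cancels the left half of the conjugation of \<open>u\<close>
  by \<open>g\<close>. Hence substitution multiplies the group component by \<open>u\<close> on the
  left and by \<open>v\<close> on the right.\<close>

lemma rack_eval_subst_x_act_word:
  fixes \<rho> :: "nat \<Rightarrow> letter \<times> 'g::group_add"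
  assumes s: "rack_eval d \<rho> s = (b, g)" and u: "fst ` set u \<subseteq> {X}" and v: "X \<notin> fst ` set v"
  shows "rack_eval d \<rho> (subst_x (act_word (Con X) (u @ v)) s) =
    (b, word_eval (\<lambda>_. d b) u + g + word_eval d v)"
proof -
  let ?d = "d(X := - g + d b + g)"
  have "word_eval ?d u = word_eval (\<lambda>_. - g + d b + g) u"
    using u by (intro word_eval_cong) auto
  also have "\<dots> = - g + word_eval (\<lambda>_. d b) u + g"
    by (rule word_eval_conjugate)
  finally have "word_eval ?d u = - g + word_eval (\<lambda>_. d b) u + g" .
  moreover have "word_eval ?d v = word_eval d v"
    using v by (intro word_eval_cong) (metis fun_upd_other)
  ultimately have "rack_eval ?d \<rho> (act_word (Con X) (u @ v)) =
      (X, - g + word_eval (\<lambda>_. d b) u + g + word_eval d v)"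
    by (simp add: rack_eval_act_word add.assoc)
  from rack_eval_subst_x[OF _ s this, of UNIV] show ?thesis
    by (simp add: add.assoc del: act_word_simps)
qed

text \<open>Covers both composites in the invertibility condition: the word of the composite is
  \<open>u u' v' v\<close>, which collapses in two pairs.\<close>

lemma rack_eval_subst_x_X:
  fixes \<rho> :: "nat \<Rightarrow> letter \<times> letter free_group"
  assumes "rack_eval gen \<rho> s = (X, word_eval gen (u' @ v'))"
    and "fst ` set u \<subseteq> {X}" "X \<notin> fst ` set v"
    and "word_eval gen u + word_eval gen u' = 0" "word_eval gen v' + word_eval gen v = 0"
  shows "rack_eval gen \<rho> (subst_x (act_word (Con X) (u @ v)) s) = (X, 0)"
proof -
  have "word_eval (\<lambda>_. gen X) u = word_eval gen u"
    using assms(2) by (intro word_eval_cong) auto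
  moreover have "word_eval gen u + word_eval gen (u' @ v') + word_eval gen v =
      (word_eval gen u + word_eval gen u') + (word_eval gen v' + word_eval gen v)"
    by (simp add: add.assoc)
  ultimately show ?thesis
    using rack_eval_subst_x_act_word[OF assms(1-3)] assms(4,5) by simp
qed

section \<open>Words of the stated form give isotropy elements\<close>

lemma X_notin_generators [simp]: "X \<notin> generators n"
  by (auto simp: generators_def)

lemma isotropy_invertible_act_word:
  assumes u: "fst ` set u \<subseteq> {X}" and v: "fst ` set v \<subseteq> generators n"
  shows "isotropy_invertible n (act_word (Con X) (u @ v))"
proof -
  \<comment> \<open>The candidate inverse has word \<open>u^-1 v^-1\<close>, not
    \<open>v^-1 u^-1\<close>, because under substitution \<open>u\<close> multiplies on the left and
    \<open>v\<close> on the right.\<close>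
  let ?t = "act_word (Con X :: (letter, nat) rterm) (u @ v)"
    and ?s = "act_word (Con X :: (letter, nat) rterm) (word_inv u @ word_inv v)"
  have closed: "?t \<in> closed_terms (x_gens n)" "?s \<in> closed_terms (x_gens n)"
    using u v by auto
  have Xv: "X \<notin> fst ` set v"
    using v X_notin_generators by blast
  have eval: "rack_eval gen \<rho> (act_word (Con X) w) = (X, word_eval gen w)" for w \<rho>
    by (simp add: rack_eval_act_word)
  have "rack_eval gen undefined (subst_x ?t ?s) = (X, 0)"
    using u Xv by (intro rack_eval_subst_x_X[OF eval]) (simp_all add: word_eval_word_inv)
  moreover have "rack_eval gen undefined (subst_x ?s ?t) = (X, 0)"
    using u Xv by (intro rack_eval_subst_x_X[OF eval]) (simp_all add: word_eval_word_inv)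
  ultimately show ?thesis
    unfolding isotropy_invertible_def using closed
    by (intro bexI[of _ ?s] conjI rack_eval_complete[where \<rho> = undefined])
      (auto intro!: closed_subst_x[where C = "generators n"]
        simp del: closed_terms_simps(3) act_word_simps)
qed

text \<open>With \<open>?p\<close>, \<open>?q\<close>, \<open>?z\<close>, \<open>?v\<close> as in
  the proof, the two sides have group components \<open>?p + ?z + ?v\<close> and
  \<open>?p - ?q + ?z + ?q + ?v\<close>. They agree since \<open>?q\<close> and \<open>?z\<close>
  are both multiples of \<open>gen X1\<close>.\<close>

lemma commutes_generically_act_word:
  assumes u: "fst ` set u \<subseteq> {X}" and v: "fst ` set v \<subseteq> generators n"
  shows "commutes_generically n (act_word (Con X) (u @ v))"
  unfolding commutes_generically_def
proof
  fix e
  let ?t = "act_word (Con X :: (letter, nat) rterm) (u @ v)" and ?C = "{X0, X1} \<union> generators n"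
  have t: "?t \<in> closed_terms (x_gens n)"
    using u v by auto
  have Xv: "X \<notin> fst ` set v"
    using v X_notin_generators by blast
  note eval = rack_eval_subst_x_act_word[OF _ u Xv, where d = gen and \<rho> = "undefined :: nat \<Rightarrow> _"]
  let ?p = "word_eval (\<lambda>_. gen X0) u" and ?q = "word_eval (\<lambda>_. gen X1) u"
    and ?z = "sign_times e (gen X1)" and ?v = "word_eval gen v"
  have "?q + ?z = ?z + ?q"
    by (intro word_eval_commute) auto
  then have "- ?q + (?z + (?q + ?v)) = ?z + ?v"
    by (metis add.assoc minus_add_cancel)
  then have "rack_eval gen undefined (subst_x ?t (Con X0 \<lhd>\<^bsup>e\<^esup> Con X1)) =
      rack_eval gen undefined (subst_x ?t (Con X0) \<lhd>\<^bsup>e\<^esup> subst_x ?t (Con X1))"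
    using eval[of "Con X0 \<lhd>\<^bsup>e\<^esup> Con X1" X0 ?z] eval[of "Con X0" X0 0] eval[of "Con X1" X1 0]
    by (simp add: add.assoc minus_add del: add_uminus_conv_diff act_word_simps)
  then show "rack_provable ?C (subst_x ?t (Con X0 \<lhd>\<^bsup>e\<^esup> Con X1))
      (subst_x ?t (Con X0) \<lhd>\<^bsup>e\<^esup> subst_x ?t (Con X1))"
    using t
    by (intro rack_eval_complete[where \<rho> = undefined])
      (auto intro!: closed_subst_x[where C = "generators n"]
        simp del: closed_terms_simps(3) act_word_simps)
qed

section \<open>Isotropy elements come from words of the stated form\<close>

lemma isotropy_normal_form:
  assumes t: "t \<in> closed_terms (x_gens n)"
    and inv: "isotropy_invertible n t" and comm: "commutes_generically n t"
  obtains k e v where "fst ` set v \<subseteq> generators n" "reduced_word v"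
    "rack_provable (x_gens n) t (act_word (Con X) (replicate k (X, e) @ v))"
proof -
  obtain a w where w: "a \<in> x_gens n" "fst ` set w \<subseteq> x_gens n"
    "rack_provable (x_gens n) t (act_word (Con a) w)"
    using closed_term_normal_form[OF t] .
  have eval_t: "rack_eval d undefined t = (a, word_eval d w)" for d :: "letter \<Rightarrow> letter free_group"
    by (simp add: rack_eval_sound[OF w(3)] rack_eval_act_word)
  note eval_subst = rack_eval_subst_x[OF t _ eval_t, where \<rho> = undefined]
  obtain s where s: "rack_provable (x_gens n) (subst_x t s) (Con X)"
    using inv by (auto simp: isotropy_invertible_def)
  obtain b g where bg: "rack_eval gen undefined s = (b, g)"
    by fastforce
  \<comment> \<open>A leading letter other than x would survive the substitution, yet the result
    must have leading letter x.\<close>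
  have "a = X"
    using rack_eval_sound[OF s, of gen undefined] eval_subst[OF bg] by (auto split: if_splits)
  \<comment> \<open>Making \<open>X0\<close> trivial erases x from \<open>w\<close> in the value of
    \<open>t[x0/x]\<close>, and also in that of the left-hand side, since a conjugate of 0 is 0.
    Letting \<open>X1\<close> act as x makes \<open>t[x1/x]\<close> recover \<open>w\<close>
    itself.\<close>
  define d where "d = gen(X0 := 0, X1 := gen X)"
  let ?v = "filter (\<lambda>p. fst p \<noteq> X) w"
  have d_w: "word_eval (d(X := h)) w = word_eval (gen(X := h)) w" for h
    using w(2) by (intro word_eval_cong) (auto simp: d_def generators_def)
  have d0: "d X0 = 0" and d1: "d X1 = gen X"
    by (simp_all add: d_def)
  have v: "word_eval (gen(X := 0)) w = free_word ?v"
    by (simp add: word_eval_erase word_eval_gen)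
  have "rack_provable ({X0, X1} \<union> generators n)
      (subst_x t (Con X0 \<lhd>\<^bsup>Pos\<^esup> Con X1)) (subst_x t (Con X0) \<lhd>\<^bsup>Pos\<^esup> subst_x t (Con X1))"
    using comm by (auto simp: commutes_generically_def)
  from rack_eval_sound[OF this, of d undefined]
  have "gen X + free_word ?v = free_word ?v + (- free_word w + (gen X + free_word w))"
    using eval_subst[where d = d and s = "Con X0 \<lhd>\<^bsup>Pos\<^esup> Con X1" and b = X0 and g = "gen X"]
      eval_subst[where d = d and s = "Con X0" and b = X0 and g = 0]
      eval_subst[where d = d and s = "Con X1" and b = X1 and g = 0]
    by (simp add: \<open>a = X\<close> d0 d1 d_w v word_eval_gen)
  then have "(free_word w - free_word ?v) + gen X = gen X + (free_word w - free_word ?v)"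
    by (metis (no_types, lifting) add.assoc add_diff_eq add_minus_cancel diff_add_cancel diff_eq_eq)
  then obtain k e where "free_word w - free_word ?v = free_word (replicate k (X, e))"
    by (rule centralizer_gen)
  \<comment> \<open>Deleting the letters x may create new cancellations, so the remaining word is
    reduced again.\<close>
  then have kw: "free_word w = free_word (replicate k (X, e) @ reduce ?v)"
    by (simp add: free_word_append diff_eq_eq)
  have gens: "fst ` set (reduce ?v) \<subseteq> generators n"
    using set_reduce[of ?v] w(2) by fastforce
  have "rack_provable (x_gens n) t (act_word (Con X) (replicate k (X, e) @ reduce ?v))"
  proof (rule rack_eval_complete[OF t, where \<rho> = undefined])
    show "act_word (Con X) (replicate k (X, e) @ reduce ?v) \<in> closed_terms (x_gens n)"
      using gens by auto
    show "rack_eval gen undefined t =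
        rack_eval gen undefined (act_word (Con X) (replicate k (X, e) @ reduce ?v))"
      by (simp add: eval_t rack_eval_act_word word_eval_gen kw \<open>a = X\<close> del: act_word_simps word_eval_simps)
  qed
  with gens show ?thesis
    using that by simp
qed

section \<open>Passage to lists of signs and indices\<close>

lemma fst_set_x_word: "fst ` set (x_word ds) \<subseteq> {X}"
  by (auto simp: x_word_def)

lemma fst_set_y_word:
  "fst ` set (y_word ys) \<subseteq> generators n \<longleftrightarrow> (\<forall>(i, e) \<in> set ys. 1 \<le> i \<and> i \<le> n)"
  by (force simp: y_word_def generators_def)

lemma y_word_exists:
  assumes "fst ` set v \<subseteq> generators n"
  obtains ys where "v = y_word ys"
proof -
  have "\<exists>ys. v = y_word ys"
    using assms
  proof (induction v)
    case Nil
    then show ?case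
      by (simp add: y_word_def)
  next
    case (Cons p v)
    then obtain ys i e where "v = y_word ys" "p = (Y i, e)"
      by (cases p) (auto simp: generators_def)
    then have "p # v = y_word ((i, e) # ys)"
      by (simp add: y_word_def)
    then show ?case ..
  qed
  then show ?thesis
    using that by blast
qed

theorem theorem4p10:
  fixes n :: nat and t :: "(letter, nat) rterm"
  assumes "t \<in> closed_terms (x_gens n)"
  shows "rack_class (x_gens n) t \<in> carrier (rack_isotropy_group n) \<longleftrightarrow>
    (\<exists>(ds :: sign list) (ys :: (nat \<times> sign) list).
      (\<forall>(i, e) \<in> set ys. 1 \<le> i \<and> i \<le> n) \<and>
      rack_class (x_gens n) t =
        rack_class (x_gens n)
          (act_word (Con X) (map (\<lambda>d. (X, d)) ds @ map (\<lambda>(i, e). (Y i, e)) ys)) \<and>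
      reduced_word (map (\<lambda>d. (X, d)) ds @ map (\<lambda>(i, e). (Y i, e)) ys))"
  unfolding x_word_def[symmetric] y_word_def[symmetric] fst_set_y_word[symmetric]
proof
  assume "rack_class (x_gens n) t \<in> carrier (rack_isotropy_group n)"
  \<comment> \<open>Membership in the carrier only provides some representative \<open>t'\<close> of
    the class with the two properties; its normal form carries over to \<open>t\<close> through
    equality of classes.\<close>
  then obtain t' where t': "rack_class (x_gens n) t = rack_class (x_gens n) t'"
    "t' \<in> closed_terms (x_gens n)" "isotropy_invertible n t'" "commutes_generically n t'"
    by (auto simp: rack_isotropy_group_def)
  obtain k e v where v: "fst ` set v \<subseteq> generators n" "reduced_word v"
    "rack_provable (x_gens n) t' (act_word (Con X) (replicate k (X, e) @ v))"
    using isotropy_normal_form[OF t'(2-4)] .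
  obtain ys where ys: "v = y_word ys"
    using y_word_exists[OF v(1)] .
  have x: "replicate k (X, e) = x_word (replicate k e)"
    by (simp add: x_word_def)
  have "act_word (Con X) (replicate k (X, e) @ v) \<in> closed_terms (x_gens n)"
    using v(1) by auto
  then have "rack_class (x_gens n) t =
      rack_class (x_gens n) (act_word (Con X) (replicate k (X, e) @ v))"
    using v(3) t'(1) rack_class_eq_iff by metis
  \<comment> \<open>The two parts share no letter, so nothing can cancel where they meet.\<close>
  moreover have "reduced_word (replicate k (X, e) @ v)"
    using v(1,2) X_notin_generators[of n]
    by (intro reduced_word_append reduced_word_replicate) auto
  ultimately show "\<exists>ds ys. fst ` set (y_word ys) \<subseteq> generators n \<and>
      rack_class (x_gens n) t = rack_class (x_gens n) (act_word (Con X) (x_word ds @ y_word ys)) \<and>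
      reduced_word (x_word ds @ y_word ys)"
    using v(1) unfolding x ys by blast
next
  assume "\<exists>ds ys. fst ` set (y_word ys) \<subseteq> generators n \<and>
      rack_class (x_gens n) t = rack_class (x_gens n) (act_word (Con X) (x_word ds @ y_word ys)) \<and>
      reduced_word (x_word ds @ y_word ys)"
  then obtain ds ys where *: "fst ` set (y_word ys) \<subseteq> generators n"
    "rack_class (x_gens n) t = rack_class (x_gens n) (act_word (Con X) (x_word ds @ y_word ys))"
    by blast
  have "act_word (Con X) (x_word ds @ y_word ys) \<in> closed_terms (x_gens n)"
    using *(1) fst_set_x_word[of ds] by auto
  then show "rack_class (x_gens n) t \<in> carrier (rack_isotropy_group n)"
    using * isotropy_invertible_act_word[OF fst_set_x_word *(1)]
      commutes_generically_act_word[OF fst_set_x_word *(1)]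
    unfolding rack_isotropy_group_def by (auto simp del: act_word_simps)
qed

end
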